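(* Let $\mathbb F_q$ be a finite field with $q$ elements. Let $d,e,r$ be positive integers and let $\square\subseteq\mathbb R^2$ be the polytope with vertices $(0,0),(d,0),(d,e+rd),(0,e)$. Assume that $d\le q-2$, $e\le q-2$ and $e+rd\le q-2$. Let $U=\mathbb Z^2\cap\square$. Let $\mathcal M(U)$ be the linear secret sharing scheme with support $T(\mathbb F_q)=(\mathbb F_q^* )^2$ and $(q-1)^2-1$ players. Then the number of lattice points in $\square$ is $$|U|=(d+1)(e+1)+r\,\frac{d(d+1)}{2},$$ the maximal number of zeros on $T(\mathbb F_q)$ of a non-zero function $f\in\mathbb F_q[U]$ is $$\max\{d(q-1)+(q-1-d)e,\ (q-1)(e+dr)\},$$ and the reconstruction threshold of $\mathcal M(U)$ is $$r(U)=1+\max\{d(q-1)+(q-1-d)e,\ (q-1)(e+dr)\}.$$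
   Context: $\mathbb F_q[U]$ is the $\mathbb F_q$-linear span of the monomials $X_1^{u_1}X_2^{u_2}$, $(u_1,u_2)\in U$, in $\mathbb F_q[X_1^{\pm1},X_2^{\pm1}]$. The scheme $\mathcal M(U)$ with support $T(\mathbb F_q)$: fix a point $P_0\in T(\mathbb F_q)$; the players are the $n=|T(\mathbb F_q)|-1$ points of $T(\mathbb F_q)\setminus\{P_0\}$. For a secret $s_0\in\mathbb F_q$, an $f\in\mathbb F_q[U]$ with $f(P_0)=s_0$ is chosen at random; the share of player $P$ is $f(P)$. A set $A$ of players determines the secret if $f(P_0)$ is determined by $(f(P))_{P\in A}$, i.e. if every $f\in\mathbb F_q[U]$ vanishing on $A$ satisfies $f(P_0)=0$. The reconstruction threshold $r(U)$ is the smallest integer $m\ge 0$ such that every set of at least $m$ players determines the secret (for $m=n+1$ the condition is vacuous). *)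

theory Defs
  imports "HOL-Analysis.Analysis" "HOL-Library.Poly_Mapping" "HOL-Library.Product_Plus"
begin

(* Laurent polynomials in X1, X2: coefficient functions of finite support on the exponent
   group Z x Z; the product of the type poly_mapping is convolution. *)
type_synonym 'a laurent2 = "(int \<times> int) \<Rightarrow>\<^sub>0 'a"

definition laurent_monom :: "int \<times> int \<Rightarrow> 'a::field laurent2" where
  "laurent_monom u = Poly_Mapping.single u 1"

definition laurent_scale :: "'a::field \<Rightarrow> 'a laurent2 \<Rightarrow> 'a laurent2" where
  "laurent_scale c f = Poly_Mapping.single 0 c * f"

interpretation laurent: module "laurent_scale :: 'a::field \<Rightarrow> 'a laurent2 \<Rightarrow> 'a laurent2"
  by unfold_locales
    (simp_all add: laurent_scale_def algebra_simps single_add mult_single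
       flip: mult.assoc)

definition laurent_span :: "(int \<times> int) set \<Rightarrow> 'a::field laurent2 set" where
  "laurent_span U = module.span laurent_scale (laurent_monom ` U)"

definition laurent_eval :: "'a::field laurent2 \<Rightarrow> 'a \<times> 'a \<Rightarrow> 'a" where
  "laurent_eval f P = (\<Sum>u\<in>Poly_Mapping.keys f.
     Poly_Mapping.lookup f u * (fst P powi fst u * snd P powi snd u))"

definition torus :: "('a::field \<times> 'a) set" where
  "torus = {(x, y). x \<noteq> 0 \<and> y \<noteq> 0}"

definition torus_zeros :: "'a::field laurent2 \<Rightarrow> ('a \<times> 'a) set" where
  "torus_zeros f = {P \<in> torus. laurent_eval f P = 0}"

definition players :: "'a::field \<times> 'a \<Rightarrow> ('a \<times> 'a) set" where
  "players P0 = torus - {P0}"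

(* In the scheme M(U) with distinguished point P0, the function f has secret f(P0) and
   gives the share f(P) to the player P. *)
definition determines_secret ::
    "(int \<times> int) set \<Rightarrow> 'a::field \<times> 'a \<Rightarrow> ('a \<times> 'a) set \<Rightarrow> bool" where
  "determines_secret U P0 A \<longleftrightarrow>
     (\<forall>f\<in>laurent_span U. \<forall>g\<in>laurent_span U.
        (\<forall>P\<in>A. laurent_eval f P = laurent_eval g P) \<longrightarrow> laurent_eval f P0 = laurent_eval g P0)"

definition reconstruction_threshold :: "(int \<times> int) set \<Rightarrow> 'a::field \<times> 'a \<Rightarrow> nat" where
  "reconstruction_threshold U P0 =
     (LEAST m. \<forall>A\<subseteq>players P0. m \<le> card A \<longrightarrow> determines_secret U P0 A)"

definition lattice_points :: "(real \<times> real) set \<Rightarrow> (int \<times> int) set" where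
  "lattice_points S = {(i, j). (real_of_int i, real_of_int j) \<in> S}"

definition trapezoid :: "nat \<Rightarrow> nat \<Rightarrow> nat \<Rightarrow> (real \<times> real) set" where
  "trapezoid d e r = convex hull {(0, 0), (real d, 0), (real d, real (e + r * d)), (0, real e)}"

lemma laurent_eval_superset:
  assumes "finite S" "Poly_Mapping.keys f \<subseteq> S"
  shows "laurent_eval f P = (\<Sum>u\<in>S.
     Poly_Mapping.lookup f u * (fst P powi fst u * snd P powi snd u))"
  unfolding laurent_eval_def
  by (rule sum.mono_neutral_left) (use assms in \<open>auto simp: in_keys_iff\<close>)

lemma laurent_eval_zero [simp]: "laurent_eval 0 P = 0"
  by (simp add: laurent_eval_def)

lemma laurent_eval_diff: "laurent_eval (f - g) P = laurent_eval f P - laurent_eval g P"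
proof -
  let ?S = "Poly_Mapping.keys f \<union> Poly_Mapping.keys g"
  have "Poly_Mapping.keys (f - g) \<subseteq> ?S"
    by (auto simp: in_keys_iff lookup_minus)
  then show ?thesis
    by (subst (1 2 3) laurent_eval_superset[of ?S])
       (auto simp: lookup_minus algebra_simps sum_subtractf)
qed

lemma determines_secret_iff_vanishing:
  "determines_secret U P0 A \<longleftrightarrow>
     (\<forall>f\<in>laurent_span U. (\<forall>P\<in>A. laurent_eval f P = 0) \<longrightarrow> laurent_eval f P0 = 0)"
  (is "_ \<longleftrightarrow> ?R")
proof
  assume det: "determines_secret U P0 A"
  have "0 \<in> laurent_span U"
    unfolding laurent_span_def by (rule laurent.span_zero)
  with det show ?R
    unfolding determines_secret_def by fastforce
next
  assume R: ?R
  show "determines_secret U P0 A"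
    unfolding determines_secret_def
  proof (intro ballI impI)
    fix f g assume fg: "f \<in> laurent_span U" "g \<in> laurent_span U"
      and eq: "\<forall>P\<in>A. laurent_eval f P = laurent_eval g P"
    have "f - g \<in> laurent_span U"
      using fg unfolding laurent_span_def by (rule laurent.span_diff)
    moreover have "\<forall>P\<in>A. laurent_eval (f - g) P = 0"
      using eq by (simp add: laurent_eval_diff)
    ultimately have "laurent_eval (f - g) P0 = 0"
      using R by blast
    then show "laurent_eval f P0 = laurent_eval g P0"
      by (simp add: laurent_eval_diff)
  qed
qed

lemma card_torus:
  fixes T :: "('a::{field,finite} \<times> 'a) set"
  assumes "T = torus"
  shows "card T = (CARD('a) - 1)\<^sup>2"
proof -
  have "T = (UNIV - {0}) \<times> (UNIV - {0})"
    by (auto simp: assms torus_def)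
  then show ?thesis
    by (simp add: card_cartesian_product card_Diff_subset power2_eq_square)
qed

lemma card_players:
  fixes P0 :: "'a::{field,finite} \<times> 'a"
  assumes "P0 \<in> torus"
  shows "card (players P0) = (CARD('a) - 1)\<^sup>2 - 1"
  using assms by (simp add: players_def card_Diff_singleton card_torus[OF refl])

end

theory Submission
  imports Defs "HOL-Computational_Algebra.Polynomial"
begin

text \<open>
  Write \<open>f = \<Sum>j. h j * Y^j\<close> with \<open>h j\<close> a polynomial in \<open>X\<close>, and let \<open>c\<close> be the number of non-zero
  \<open>x\<close> at which all \<open>h j\<close> vanish. The exponents of \<open>h j\<close> lie between \<open>(j - e) / r\<close> and \<open>d\<close>, and a
  polynomial with exponents in an interval of length \<open>l\<close> has at most \<open>l\<close> non-zero roots; hence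
  \<open>h j = 0\<close> as soon as \<open>j > e + r * (d - c)\<close>. So every vertical line not contained in the zero set
  meets it in at most \<open>e + r * (d - c)\<close> points, which gives at most
  \<open>c * (q - 1) + (q - 1 - c) * (e + r * (d - c)) \<le> (q - 1) * (e + r * d)\<close> zeros since \<open>r \<ge> 1\<close>.
  The product of \<open>X^d\<close> with \<open>e + r * d\<close> linear factors in \<open>Y\<close> attains this bound, and its roots can
  be chosen so as to avoid \<open>P0\<close>. As \<open>r \<ge> 1\<close>, the second entry of the maximum is the larger one.
\<close>

section \<open>Spans of monomials as spaces of given support\<close>

lemma laurent_span_eq: "laurent_span U = {f. Poly_Mapping.keys f \<subseteq> U}"
proof
  have "laurent.subspace {f :: 'a::field laurent2. Poly_Mapping.keys f \<subseteq> U}"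
  proof (rule laurent.subspaceI)
    fix f g :: "'a laurent2"
    assume "f \<in> {f. Poly_Mapping.keys f \<subseteq> U}" "g \<in> {f. Poly_Mapping.keys f \<subseteq> U}"
    then show "f + g \<in> {f. Poly_Mapping.keys f \<subseteq> U}"
      using keys_add[of f g] by blast
  next
    fix c :: 'a and f :: "'a laurent2"
    assume "f \<in> {f. Poly_Mapping.keys f \<subseteq> U}"
    moreover have "Poly_Mapping.keys (laurent_scale c f) \<subseteq> Poly_Mapping.keys f"
    proof
      fix u assume "u \<in> Poly_Mapping.keys (laurent_scale c f)"
      then obtain a b where "u = a + b" "a \<in> Poly_Mapping.keys (Poly_Mapping.single 0 c)"
          "b \<in> Poly_Mapping.keys f"
        using keys_mult[of "Poly_Mapping.single 0 c" f] unfolding laurent_scale_def by blast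
      then show "u \<in> Poly_Mapping.keys f"
        by (simp split: if_splits)
    qed
    ultimately show "laurent_scale c f \<in> {f. Poly_Mapping.keys f \<subseteq> U}"
      by blast
  qed simp
  then show "laurent_span U \<subseteq> {f :: 'a laurent2. Poly_Mapping.keys f \<subseteq> U}"
    unfolding laurent_span_def by (intro laurent.span_minimal) (auto simp: laurent_monom_def)
next
  show "{f :: 'a laurent2. Poly_Mapping.keys f \<subseteq> U} \<subseteq> laurent_span U"
  proof
    fix f :: "'a laurent2"
    assume f: "f \<in> {f. Poly_Mapping.keys f \<subseteq> U}"
    have "f = (\<Sum>u\<in>Poly_Mapping.keys f. laurent_scale (Poly_Mapping.lookup f u) (laurent_monom u))"
      by (rule poly_mapping_eqI)
        (simp add: laurent_scale_def laurent_monom_def mult_single lookup_sum lookup_single when_def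
          in_keys_iff)
    also have "\<dots> \<in> laurent_span U"
      unfolding laurent_span_def using f
      by (intro laurent.span_sum laurent.span_scale laurent.span_base) auto
    finally show "f \<in> laurent_span U" .
  qed
qed

section \<open>The trapezoid and its lattice points\<close>

text \<open>The right-hand side is an intersection of four half-planes that contain the vertices.
  Conversely, each of its points lies on a vertical segment from the bottom edge to the top edge,
  and each edge consists of convex combinations of two vertices.\<close>

lemma trapezoid_eq:
  assumes "d > 0" "e > 0"
  shows "trapezoid d e r = {(x, y). 0 \<le> x \<and> x \<le> real d \<and> 0 \<le> y \<and> y \<le> real e + real r * x}"
    (is "_ = ?T")
proof
  have "?T = {p. (-1, 0) \<bullet> p \<le> 0} \<inter> {p. (1, 0) \<bullet> p \<le> real d} \<inter> {p. (0, -1) \<bullet> p \<le> 0}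
      \<inter> {p. (- real r, 1) \<bullet> p \<le> real e}"
    by (auto simp: inner_prod_def)
  then have "convex ?T"
    by (simp only:) (intro convex_Int convex_halfspace_le)
  then show "trapezoid d e r \<subseteq> ?T"
    unfolding trapezoid_def by (intro hull_minimal) auto
next
  show "?T \<subseteq> trapezoid d e r"
  proof clarify
    fix x y :: real
    assume xy: "0 \<le> x" "x \<le> real d" "0 \<le> y" "y \<le> real e + real r * x"
    let ?C = "trapezoid d e r"
    have conv: "convex ?C"
      unfolding trapezoid_def by (rule convex_convex_hull)
    have vert: "(0, 0) \<in> ?C" "(real d, 0) \<in> ?C" "(real d, real (e + r * d)) \<in> ?C" "(0, real e) \<in> ?C"
      unfolding trapezoid_def by (auto intro: hull_inc)
    define t where "t = x / real d"
    have t: "0 \<le> t" "t \<le> 1" "t * real d = x"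
      using xy assms by (auto simp: t_def)
    \<comment> \<open>Since \<open>e > 0\<close>, the vertical segment over \<open>x\<close> has
      positive length, by which \<open>y\<close> can be divided.\<close>
    have top: "real e + real r * x > 0"
      using xy assms by (intro add_pos_nonneg) auto
    define s where "s = y / (real e + real r * x)"
    have s: "0 \<le> s" "s \<le> 1" "s * (real e + real r * x) = y"
      using xy top by (auto simp: s_def)
    have "(1 - t) *\<^sub>R (0, 0) + t *\<^sub>R (real d, 0) \<in> ?C"
      using t by (intro convexD[OF conv] vert) auto
    then have lower: "(x, 0) \<in> ?C"
      using t by simp
    have "(1 - t) *\<^sub>R (0, real e) + t *\<^sub>R (real d, real (e + r * d)) \<in> ?C"
      using t by (intro convexD[OF conv] vert) auto
    also have "(1 - t) *\<^sub>R (0, real e) + t *\<^sub>R (real d, real (e + r * d)) = (x, real e + real r * x)"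
      by (simp add: t(3)[symmetric] algebra_simps)
    finally have upper: "(x, real e + real r * x) \<in> ?C" .
    have "(1 - s) *\<^sub>R (x, 0) + s *\<^sub>R (x, real e + real r * x) \<in> ?C"
      using s by (intro convexD[OF conv] lower upper) auto
    then show "(x, y) \<in> ?C"
      using s by (simp add: algebra_simps)
  qed
qed

text \<open>For an integer \<open>i\<close> the bound \<open>e + r * i\<close> is an integer too, so
  the real inequalities become integral ones. The description by columns turns counting into a sum
  over \<open>i\<close>.\<close>

lemma lattice_points_trapezoid:
  assumes "d > 0" "e > 0"
  shows "lattice_points (trapezoid d e r) = map_prod int int ` (SIGMA i:{..d}. {..e + r * i})"
proof -
  have "(i, j) \<in> map_prod int int ` (SIGMA i:{..d}. {..e + r * i})"
    if "(i, j) \<in> lattice_points (trapezoid d e r)" for i j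
  proof -
    have "0 \<le> i" "i \<le> int d" "0 \<le> j" "real_of_int j \<le> real_of_int (int e + int r * i)"
      using that by (auto simp: lattice_points_def trapezoid_eq[OF assms])
    then have "(i, j) = map_prod int int (nat i, nat j)" "nat i \<le> d"
        "int (nat j) \<le> int (e + r * nat i)"
      unfolding of_int_le_iff by auto
    then show ?thesis
      unfolding of_nat_le_iff by (intro image_eqI) auto
  qed
  moreover have "(int i, int j) \<in> lattice_points (trapezoid d e r)" if "i \<le> d" "j \<le> e + r * i" for i j
  proof -
    have "real j \<le> real (e + r * i)"
      using that by (simp only: of_nat_le_iff)
    then show ?thesis
      using that by (simp add: lattice_points_def trapezoid_eq[OF assms])
  qed
  ultimately show ?thesis
    by auto
qed

lemma card_lattice_points_trapezoid:
  assumes "d > 0" "e > 0"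
  shows "real (card (lattice_points (trapezoid d e r)))
    = (real d + 1) * (real e + 1) + real r * (real d * (real d + 1) / 2)"
proof -
  have "card (lattice_points (trapezoid d e r)) = (\<Sum>i\<le>d. e + r * i + 1)"
    unfolding lattice_points_trapezoid[OF assms]
    by (subst card_image) (auto simp: inj_on_def)
  moreover have "real (\<Sum>i\<le>d. e + r * i + 1)
      = (real d + 1) * (real e + 1) + real r * (real d * (real d + 1) / 2)"
    by (induction d) (auto simp: field_simps)
  ultimately show ?thesis
    by simp
qed

section \<open>Upper bound for the number of zeros\<close>

text \<open>The factor \<open>X^m\<close> splits off and has no non-zero root, so only the cofactor,
  of degree \<open>degree p - m\<close>, contributes.\<close>

lemma card_nonzero_roots_le:
  fixes p :: "'a::field poly"
  assumes "p \<noteq> 0" "\<And>k. k < m \<Longrightarrow> coeff p k = 0"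
  shows "m + card {x. x \<noteq> 0 \<and> poly p x = 0} \<le> degree p"
proof -
  have "monom 1 m dvd p"
    using assms(2) by (simp add: monom_1_dvd_iff')
  then obtain g where g: "p = monom 1 m * g" ..
  then have g0: "g \<noteq> 0"
    using assms(1) by auto
  have "card {x. x \<noteq> 0 \<and> poly p x = 0} \<le> card {x. poly g x = 0}"
    using poly_roots_finite[OF g0] by (intro card_mono) (auto simp: g poly_monom)
  also have "\<dots> \<le> degree g"
    by (rule card_poly_roots_bound[OF g0])
  finally show ?thesis
    using g0 by (simp add: g degree_mult_eq degree_monom_eq monom_eq_0_iff)
qed

lemma laurent_eval_nat_box:
  assumes "Poly_Mapping.keys f \<subseteq> map_prod int int ` ({..m} \<times> {..n})"
  shows "laurent_eval f (x, y)
    = (\<Sum>j\<le>n. (\<Sum>i\<le>m. Poly_Mapping.lookup f (int i, int j) * x ^ i) * y ^ j)"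
proof -
  have "laurent_eval f (x, y) = (\<Sum>u\<in>map_prod int int ` ({..m} \<times> {..n}).
      Poly_Mapping.lookup f u * (x powi fst u * y powi snd u))"
    using assms by (subst laurent_eval_superset) auto
  also have "\<dots> = (\<Sum>(i, j)\<in>{..m} \<times> {..n}.
      Poly_Mapping.lookup f (int i, int j) * (x ^ i * y ^ j))"
    by (subst sum.reindex) (auto simp: inj_on_def intro!: sum.cong)
  also have "\<dots> = (\<Sum>i\<le>m. \<Sum>j\<le>n. Poly_Mapping.lookup f (int i, int j) * (x ^ i * y ^ j))"
    by (rule sum.cartesian_product[symmetric])
  also have "\<dots> = (\<Sum>j\<le>n. \<Sum>i\<le>m. Poly_Mapping.lookup f (int i, int j) * (x ^ i * y ^ j))"
    by (rule sum.swap)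
  finally show ?thesis
    by (simp add: sum_distrib_right mult.assoc)
qed

text \<open>The last column is the tallest. In the enclosing box the double sums are rectangular, so
  their order can be exchanged.\<close>

lemma lattice_points_trapezoid_subset:
  assumes "d > 0" "e > 0"
  shows "lattice_points (trapezoid d e r) \<subseteq> map_prod int int ` ({..d} \<times> {..e + r * d})"
proof -
  have "j \<le> e + r * d" if "i \<le> d" "j \<le> e + r * i" for i j
    using that mult_le_mono2[of i d r] by linarith
  then show ?thesis
    unfolding lattice_points_trapezoid[OF assms] by (intro image_mono) auto
qed

lemma card_torus_zeros_le:
  fixes f :: "'a::{field,finite} laurent2"
  assumes "d > 0" "e > 0" "r > 0"
    and f: "f \<in> laurent_span (lattice_points (trapezoid d e r))" "f \<noteq> 0"
  shows "card (torus_zeros f) \<le> (CARD('a) - 1) * (e + r * d)"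
proof -
  let ?D = "e + r * d" and ?N = "CARD('a) - 1"
  let ?K = "UNIV - {0} :: 'a set"
  have keys: "Poly_Mapping.keys f \<subseteq> map_prod int int ` (SIGMA i:{..d}. {..e + r * i})"
    using f by (simp add: laurent_span_eq lattice_points_trapezoid assms(1,2))
  have keys_box: "Poly_Mapping.keys f \<subseteq> map_prod int int ` ({..d} \<times> {..?D})"
    using f(1) lattice_points_trapezoid_subset[OF assms(1,2)] by (auto simp: laurent_span_eq)
  have lookup_zero: "Poly_Mapping.lookup f (int i, int j) = 0" if "i > d \<or> j > e + r * i" for i j
    using keys that by (force simp: in_keys_iff)
  \<comment> \<open>\<open>h j\<close> is the coefficient of \<open>Y^j\<close>, a polynomial in
    \<open>X\<close>; \<open>k x\<close> is the restriction of \<open>f\<close> to the vertical line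
    over \<open>x\<close>, a polynomial in \<open>Y\<close>.\<close>
  define h where "h j = (\<Sum>i\<le>d. monom (Poly_Mapping.lookup f (int i, int j)) i)" for j
  define k where "k x = (\<Sum>j\<le>?D. monom (poly (h j) x) j)" for x
  have coeff_h: "coeff (h j) i = Poly_Mapping.lookup f (int i, int j)" for i j
    using lookup_zero[of i j] by (auto simp: h_def coeff_sum)
  have deg_h: "degree (h j) \<le> d" for j
    by (rule degree_le) (auto simp: coeff_h lookup_zero)
  have coeff_k: "coeff (k x) j = (if j \<le> ?D then poly (h j) x else 0)" for x j
    by (simp add: k_def coeff_sum)
  have eval: "laurent_eval f (x, y) = poly (k x) y" for x y
    by (simp add: laurent_eval_nat_box[OF keys_box] k_def h_def poly_sum poly_monom)
  define C where "C = {x. x \<noteq> 0 \<and> k x = 0}"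
  obtain u where u: "Poly_Mapping.lookup f u \<noteq> 0"
    using f(2) by (metis lookup_zero poly_mapping_eqI Poly_Mapping.lookup_zero)
  have h_bound: "j \<le> e + r * (d - card C) \<and> card C \<le> d" if hj: "h j \<noteq> 0" for j
  proof -
    obtain i where i: "coeff (h j) i \<noteq> 0"
      using hj by (auto simp: poly_eq_iff)
    then have "i \<le> d" "j \<le> e + r * i"
      using lookup_zero[of i j] by (auto simp: coeff_h simp flip: not_less)
    \<comment> \<open>Only for such \<open>j\<close> does \<open>k x = 0\<close> yield
      \<open>poly (h j) x = 0\<close>.\<close>
    then have "j \<le> ?D"
      using mult_le_mono2[of i d r] by linarith
    then have "C \<subseteq> {x. x \<noteq> 0 \<and> poly (h j) x = 0}"
      by (auto simp: C_def poly_eq_iff coeff_k split: if_splits)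
    then have C: "card C \<le> card {x. x \<noteq> 0 \<and> poly (h j) x = 0}"
      by (intro card_mono) auto
    have "card C \<le> d"
      using C card_nonzero_roots_le[OF hj, of 0] deg_h[of j] by simp
    moreover have "j \<le> e + r * (d - card C)"
    proof (rule ccontr)
      assume j: "\<not> j \<le> e + r * (d - card C)"
      \<comment> \<open>The exponents of \<open>h j\<close> now start at
        \<open>d - card C + 1\<close> or later, which leaves room for fewer than
        \<open>card C\<close> non-zero roots, although all elements of \<open>C\<close> are
        roots.\<close>
      have "coeff (h j) i = 0" if "i < Suc (d - card C)" for i
        using j that mult_le_mono2[of i "d - card C" r] by (intro trans[OF coeff_h lookup_zero]) linarith
      then have "Suc (d - card C) + card {x. x \<noteq> 0 \<and> poly (h j) x = 0} \<le> degree (h j)"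
        by (intro card_nonzero_roots_le hj)
      then show False
        using C deg_h[of j] \<open>card C \<le> d\<close> by linarith
    qed
    ultimately show ?thesis
      by blast
  qed
  \<comment> \<open>Some \<open>h j\<close> is non-zero because \<open>f\<close> is. The bound makes
    the truncated subtraction \<open>d - card C\<close> a true difference.\<close>
  have "card C \<le> d"
  proof -
    obtain i j where "u = (int i, int j)"
      using u keys by (force simp: in_keys_iff)
    then have "h j \<noteq> 0"
      using u coeff_h[of j i] by auto
    then show ?thesis
      using h_bound by blast
  qed
  define E where "E = e + r * (d - card C)"
  have fibre: "card {y. y \<noteq> 0 \<and> poly (k x) y = 0} \<le> E" if "k x \<noteq> 0" for x
  proof -
    have "h j = 0" if "j > E" for j
      using h_bound[of j] that by (auto simp: E_def)
    then have "degree (k x) \<le> E"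
      by (intro degree_le) (auto simp: coeff_k)
    then show ?thesis
      using card_nonzero_roots_le[OF that, of 0] by simp
  qed
  have zeros: "torus_zeros f = (SIGMA x:?K. {y. y \<noteq> 0 \<and> poly (k x) y = 0})"
    by (auto simp: torus_zeros_def torus_def eval)
  have cardK: "card ?K = ?N"
    by (simp add: card_Diff_subset)
  have "C \<subseteq> ?K"
    by (auto simp: C_def)
  have "card (torus_zeros f) = (\<Sum>x\<in>?K. card {y. y \<noteq> 0 \<and> poly (k x) y = 0})"
    unfolding zeros by (rule card_SigmaI) auto
  \<comment> \<open>\<open>E\<close> is counted on the lines over \<open>C\<close> as well. The
    total still fits, since \<open>r \<ge> 1\<close> gives
    \<open>card C \<le> r * card C\<close>.\<close>
  also have "\<dots> \<le> (\<Sum>x\<in>?K. E + (if x \<in> C then ?N else 0))"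
  proof (rule sum_mono)
    fix x assume "x \<in> ?K"
    have "card {y. y \<noteq> 0 \<and> poly (k x) y = 0} \<le> card ?K"
      by (rule card_mono) auto
    then show "card {y. y \<noteq> 0 \<and> poly (k x) y = 0} \<le> E + (if x \<in> C then ?N else 0)"
      using fibre[of x] \<open>x \<in> ?K\<close> cardK by (auto simp: C_def)
  qed
  also have "\<dots> = ?N * E + card C * ?N"
    using \<open>C \<subseteq> ?K\<close> by (simp add: sum.distrib cardK sum.If_cases Int_absorb1 del: Diff_iff)
  also have "\<dots> \<le> ?N * (E + r * card C)"
    unfolding add_mult_distrib2 mult.commute[of "card C" ?N]
    using assms(3) by (intro add_left_mono mult_le_mono2) simp
  also have "E + r * card C = ?D"
    using \<open>card C \<le> d\<close> by (simp add: E_def flip: add_mult_distrib2)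
  finally show ?thesis .
qed

section \<open>A function attaining the bound\<close>

lemma extremal_laurent_polynomial:
  fixes P0 :: "'a::{field,finite} \<times> 'a"
  assumes "d > 0" "e > 0" "e + r * d \<le> CARD('a) - 2" "P0 \<in> torus"
  obtains f :: "'a laurent2"
  where "f \<in> laurent_span (lattice_points (trapezoid d e r))" "laurent_eval f P0 \<noteq> 0"
    "card (torus_zeros f) = (CARD('a) - 1) * (e + r * d)"
proof -
  let ?D = "e + r * d"
  \<comment> \<open>Roots in \<open>Y\<close> must avoid 0, to lie on the torus, and the second
    coordinate of \<open>P0\<close>. This is where the 2 in the bound on \<open>e + r * d\<close>
    comes from.\<close>
  have "card (UNIV - {0, snd P0}) = CARD('a) - 2"
    using assms(4) by (auto simp: torus_def card_Diff_subset)
  with assms(3) obtain B where B: "B \<subseteq> UNIV - {0, snd P0}" "card B = ?D"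
    by (metis obtain_subset_with_card_n)
  define p where "p = (\<Prod>b\<in>B. [:- b, 1:])"
  have "degree p \<le> ?D"
    using degree_prod_sum_le[of B "\<lambda>b. [:- b, 1:]"] B(2) by (simp add: p_def)
  have poly_p: "poly p y = 0 \<longleftrightarrow> y \<in> B" for y
    by (auto simp: p_def poly_prod)
  \<comment> \<open>The column over \<open>d\<close> has room for all powers of \<open>Y\<close> up
    to \<open>e + r * d\<close>.\<close>
  define f where "f = (\<Sum>j\<le>?D. Poly_Mapping.single (int d, int j) (coeff p j))"
  have lookup_f: "Poly_Mapping.lookup f (i, j)
      = (if i = int d \<and> 0 \<le> j \<and> j \<le> int ?D then coeff p (nat j) else 0)" for i j
  proof -
    \<comment> \<open>The guard \<open>0 \<le> j\<close> excludes negative \<open>j\<close>, for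
      which \<open>nat j\<close> would be 0.\<close>
    have "Poly_Mapping.lookup f (i, j) = (\<Sum>n\<le>?D. if n = nat j then
        (if i = int d \<and> 0 \<le> j then coeff p n else 0) else 0)"
      unfolding f_def lookup_sum by (intro sum.cong) (auto simp: lookup_single when_def)
    then show ?thesis
      by (auto simp: nat_le_iff)
  qed
  have "Poly_Mapping.keys f \<subseteq> lattice_points (trapezoid d e r)"
  proof
    fix u assume "u \<in> Poly_Mapping.keys f"
    then have "fst u = int d" "0 \<le> snd u" "snd u \<le> int ?D"
      using lookup_f[of "fst u" "snd u"] by (auto simp: in_keys_iff split: if_splits)
    then have "u = map_prod int int (d, nat (snd u))" "nat (snd u) \<le> ?D"
      by (simp_all only: nat_le_iff) (simp add: prod_eq_iff)
    then show "u \<in> lattice_points (trapezoid d e r)"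
      unfolding lattice_points_trapezoid[OF assms(1,2)] by blast
  qed
  then have f: "f \<in> laurent_span (lattice_points (trapezoid d e r))"
    by (simp add: laurent_span_eq)
  have eval: "laurent_eval f (x, y) = x ^ d * poly p y" for x y
  proof -
    have "Poly_Mapping.keys f \<subseteq> map_prod int int ` ({..d} \<times> {..?D})"
      using f lattice_points_trapezoid_subset[OF assms(1,2)] by (auto simp: laurent_span_eq)
    then have "laurent_eval f (x, y)
        = (\<Sum>j\<le>?D. (\<Sum>i\<le>d. Poly_Mapping.lookup f (int i, int j) * x ^ i) * y ^ j)"
      by (rule laurent_eval_nat_box)
    also have "\<dots> = (\<Sum>j\<le>?D. x ^ d * (coeff p j * y ^ j))"
    proof (rule sum.cong)
      fix j assume "j \<in> {..?D}"
      then have "(\<Sum>i\<le>d. Poly_Mapping.lookup f (int i, int j) * x ^ i)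
          = (\<Sum>i\<le>d. if i = d then coeff p j * x ^ d else 0)"
        by (intro sum.cong) (auto simp: lookup_f simp flip: of_nat_add of_nat_mult)
      then show "(\<Sum>i\<le>d. Poly_Mapping.lookup f (int i, int j) * x ^ i) * y ^ j
          = x ^ d * (coeff p j * y ^ j)"
        by simp
    qed simp
    also have "\<dots> = x ^ d * (\<Sum>j\<le>?D. coeff p j * y ^ j)"
      by (rule sum_distrib_left[symmetric])
    also have "(\<Sum>j\<le>?D. coeff p j * y ^ j) = poly p y"
      unfolding poly_altdef using \<open>degree p \<le> ?D\<close>
      by (intro sum.mono_neutral_right) (auto simp: coeff_eq_0)
    finally show ?thesis .
  qed
  have "laurent_eval f P0 \<noteq> 0"
    using assms(4) B(1) poly_p eval[of "fst P0" "snd P0"] by (auto simp: torus_def)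
  \<comment> \<open>\<open>X^d\<close> has no zero on the torus, so the zeros fill one horizontal
    line for each element of \<open>B\<close>.\<close>
  moreover have "torus_zeros f = (UNIV - {0}) \<times> B"
    using B(1) by (auto simp: torus_zeros_def torus_def eval poly_p)
  then have "card (torus_zeros f) = (CARD('a) - 1) * ?D"
    using B(2) by (simp add: card_cartesian_product card_Diff_subset)
  ultimately show thesis
    using f by (rule that[rotated 1])
qed

section \<open>From zeros to the reconstruction threshold\<close>

theorem theorem4p3:
  fixes q d e r :: nat
    and P0 :: "'a::{field,finite} \<times> 'a"
    and U :: "(int \<times> int) set"
  assumes "q = CARD('a)"
    and "d > 0" "e > 0" "r > 0"
    and "d \<le> q - 2" "e \<le> q - 2" "e + r * d \<le> q - 2"
    and "U = lattice_points (trapezoid d e r)"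
    and "P0 \<in> torus"
  shows "real (card U) = (real d + 1) * (real e + 1) + real r * (real d * (real d + 1) / 2)
    \<and> Max {card (torus_zeros f) | f :: 'a laurent2. f \<in> laurent_span U \<and> f \<noteq> 0}
        = max (d * (q - 1) + (q - 1 - d) * e) ((q - 1) * (e + d * r))
    \<and> reconstruction_threshold U P0
        = 1 + max (d * (q - 1) + (q - 1 - d) * e) ((q - 1) * (e + d * r))"
proof -
  define M where "M = (q - 1) * (e + r * d)"
  have "d * (q - 1) + (q - 1 - d) * e \<le> (q - 1) * (d * r) + (q - 1) * e"
    using \<open>r > 0\<close> by (intro add_mono mult_le_mono1) (simp_all add: mult.commute)
  then have max_eq: "max (d * (q - 1) + (q - 1 - d) * e) ((q - 1) * (e + d * r)) = M"
    by (simp add: M_def algebra_simps)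
  have le: "card (torus_zeros g) \<le> M" if "g \<in> laurent_span U" "g \<noteq> 0" for g :: "'a laurent2"
    using card_torus_zeros_le[of d e r g] that assms by (simp add: M_def)
  obtain f :: "'a laurent2" where f: "f \<in> laurent_span U" "laurent_eval f P0 \<noteq> 0"
      "card (torus_zeros f) = M"
    using extremal_laurent_polynomial[of d e r P0] assms by (auto simp: M_def)
  then have "f \<noteq> 0"
    by auto
  let ?Z = "{card (torus_zeros f) | f :: 'a laurent2. f \<in> laurent_span U \<and> f \<noteq> 0}"
  have "?Z \<subseteq> {..M}"
    using le by auto
  then have "Max ?Z = M"
    using f \<open>f \<noteq> 0\<close> by (intro Max_eqI) (auto intro: finite_subset)
  moreover have "reconstruction_threshold U P0 = 1 + M"
    unfolding reconstruction_threshold_def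
  proof (rule Least_equality)
    show "\<forall>A\<subseteq>players P0. 1 + M \<le> card A \<longrightarrow> determines_secret U P0 A"
    proof (intro allI impI)
      fix A assume A: "A \<subseteq> players P0" "1 + M \<le> card A"
      \<comment> \<open>More than \<open>M\<close> zeros on the torus force \<open>g = 0\<close>,
        and then its secret is 0.\<close>
      have "g = 0" if "g \<in> laurent_span U" "\<forall>P\<in>A. laurent_eval g P = 0" for g
      proof (rule ccontr)
        assume "g \<noteq> 0"
        have "A \<subseteq> torus_zeros g"
          using A(1) that(2) by (auto simp: torus_zeros_def players_def)
        then have "card A \<le> card (torus_zeros g)"
          by (intro card_mono) auto
        then show False
          using le[OF that(1) \<open>g \<noteq> 0\<close>] A(2) by simp
      qed
      then show "determines_secret U P0 A"
        unfolding determines_secret_iff_vanishing by fastforce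
    qed
  next
    fix m assume m: "\<forall>A\<subseteq>players P0. m \<le> card A \<longrightarrow> determines_secret U P0 A"
    \<comment> \<open>The zeros of \<open>f\<close> are exactly \<open>M\<close> players whose
      shares all vanish while the secret does not, so no \<open>m \<le> M\<close> qualifies.\<close>
    have "torus_zeros f \<subseteq> players P0"
      using f(2) by (auto simp: torus_zeros_def players_def)
    moreover have "\<not> determines_secret U P0 (torus_zeros f)"
      using f unfolding determines_secret_iff_vanishing by (auto simp: torus_zeros_def)
    ultimately show "1 + M \<le> m"
      using m f(3) by (metis not_less_eq_eq plus_1_eq_Suc)
  qed
  ultimately show ?thesis
    using card_lattice_points_trapezoid[of d e r] assms(2,3,8) max_eq by simp
qed

end
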